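(* Let $A\in\mathbb{C}^{n\times n}$ have spectral radius $\rho(A)<1$. Let $s_1\ge s_2\ge\cdots\ge s_n\ge 0$ be the singular values of $A$, and for $1\le j\le n$ set $$G_j=(s_1 s_2\cdots s_j)^{1/j}.$$ Let $p$ denote the largest index $j\in\{1,\dots,n\}$ for which $G_j\ge 1$, taking $p=0$ if $G_1<1$. Then for every $k$ with $1\le k\le n$ and every $V\in\mathbb{C}^{n\times k}$ with orthonormal columns ($V^*V=I$), the matrix $V^*AV\in\mathbb{C}^{k\times k}$ has at most $p$ eigenvalues (counted with algebraic multiplicity) of magnitude at least one.
   Context: $V^*$ denotes the conjugate transpose. The matrix $V^*AV$ is the state matrix of the order-$k$ reduced-order model obtained by orthogonal projection of the discrete-time system $x_{k+1}=Ax_k+bu_k$ onto the range of $V$; its eigenvalues of magnitude at least one are called unstable modes. The spectral radius $\rho(A)$ is the maximum modulus of the eigenvalues of $A$. *)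

theory Defs
  imports
    "HOL-Computational_Algebra.Fundamental_Theorem_Algebra"
    "Jordan_Normal_Form.Spectral_Radius"
    "Jordan_Normal_Form.Schur_Decomposition"
begin

text \<open>\<^const>\<open>mat_adjoint\<close> is the conjugate transpose (also for rectangular matrices), and the
  multiplicity of an element of \<^const>\<open>proots\<close> is its order as a root, so below each eigenvalue
  occurs with its algebraic multiplicity.\<close>

definition eigvals_mset :: "complex mat \<Rightarrow> complex multiset" where
  "eigvals_mset M = proots (char_poly M)"

text \<open>The singular values in non-increasing order, as the square roots of the eigenvalues of
  \<open>A\<^sup>*A\<close>, with multiplicity. For a matrix with \<open>n\<close> columns the list has length \<open>n\<close>. The
  eigenvalues of \<open>A\<^sup>*A\<close> are real and nonnegative, so \<^const>\<open>Re\<close> only changes their type. List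
  positions start at \<open>0\<close>: the \<open>j\<close>-th largest singular value is at position \<open>j - 1\<close>.\<close>

definition singular_values :: "complex mat \<Rightarrow> real list" where
  "singular_values A =
     rev (sorted_list_of_multiset
       (image_mset (\<lambda>z. sqrt (Re z)) (eigvals_mset (mat_adjoint A * A))))"

end

theory Submission
  imports Defs "HOL-Analysis.L2_Norm"
begin

text \<open>Let \<open>m\<close> be the number of unstable modes of \<open>V\<^sup>*AV\<close>. By a unitary Schur decomposition
  with these eigenvalues in front, compressing further to the first \<open>m\<close> Schur vectors gives \<open>Q\<close> with
  orthonormal columns such that \<open>\<bar>det (Q\<^sup>*AQ)\<bar> \<ge> 1\<close>. On the other hand
  \<open>\<bar>det (Q\<^sup>*AQ)\<bar>\<^sup>2 \<le> det (Q\<^sup>*A\<^sup>*AQ) \<le> (s\<^sub>1\<cdots>s\<^sub>m)\<^sup>2\<close>: both inequalities follow from the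
  Cauchy--Binet formula, the first by the Cauchy--Schwarz inequality and the second after
  diagonalising \<open>A\<^sup>*A\<close>. Hence \<open>G\<^sub>m \<ge> 1\<close>.\<close>

section \<open>Algebra of the conjugate transpose\<close>

lemma mat_adjoint_dim [simp]:
  "dim_row (mat_adjoint A) = dim_col A" "dim_col (mat_adjoint A) = dim_row A"
  unfolding mat_adjoint_def by simp_all

lemma mat_adjoint_carrier:
  "A \<in> carrier_mat n m \<Longrightarrow> mat_adjoint A \<in> carrier_mat m n"
  by (intro carrier_matI) simp_all

lemma index_mat_adjoint [simp]:
  assumes "i < dim_col A" "j < dim_row A"
  shows "mat_adjoint A $$ (i, j) = conjugate (A $$ (j, i))"
  using assms unfolding mat_adjoint_def by (simp add: mat_of_rows_index)

lemma mat_adjoint_mult: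
  fixes A B :: "complex mat"
  assumes A: "A \<in> carrier_mat n m" and B: "B \<in> carrier_mat m k"
  shows "mat_adjoint (A * B) = mat_adjoint B * mat_adjoint A"
proof (rule eq_matI)
  fix i j assume "i < dim_row (mat_adjoint B * mat_adjoint A)"
    "j < dim_col (mat_adjoint B * mat_adjoint A)"
  then have i: "i < k" and j: "j < n"
    using A B by simp_all
  have "mat_adjoint (A * B) $$ (i, j) = cnj (\<Sum>l = 0..<m. A $$ (j, l) * B $$ (l, i))"
    using A B i j by (simp add: scalar_prod_def)
  also have "\<dots> = (\<Sum>l = 0..<m. cnj (B $$ (l, i)) * cnj (A $$ (j, l)))"
    by (simp add: mult.commute)
  also have "\<dots> = (mat_adjoint B * mat_adjoint A) $$ (i, j)"
    using A B i j by (simp add: scalar_prod_def)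
  finally show "mat_adjoint (A * B) $$ (i, j) = (mat_adjoint B * mat_adjoint A) $$ (i, j)" .
qed (use A B in simp_all)

lemma mat_adjoint_adjoint [simp]:
  fixes A :: "complex mat"
  shows "mat_adjoint (mat_adjoint A) = A"
  by (intro eq_matI) auto

section \<open>Minors and the Cauchy--Binet formula\<close>

text \<open>Being the identity outside \<open>{0..<m}\<close> keeps the set finite and closed under composition with
  permutations of \<open>{0..<m}\<close>.\<close>

definition row_choices :: "nat \<Rightarrow> nat \<Rightarrow> (nat \<Rightarrow> nat) set" where
  "row_choices m n = {f. (\<forall>i\<in>{0..<m}. f i \<in> {0..<n}) \<and> (\<forall>i. i \<notin> {0..<m} \<longrightarrow> f i = i)}"

text \<open>The rows \<open>f 0, ..., f (m - 1)\<close> may repeat or come in any order, so for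
  \<open>X\<close> with \<open>m\<close> columns this is zero or a maximal minor up to sign.\<close>

definition row_minor :: "'a :: comm_ring_1 mat \<Rightarrow> nat \<Rightarrow> (nat \<Rightarrow> nat) \<Rightarrow> 'a" where
  "row_minor X m f = det (mat m m (\<lambda>(i, j). X $$ (f i, j)))"

lemma row_choicesD: "f \<in> row_choices m n \<Longrightarrow> i < m \<Longrightarrow> f i < n"
  unfolding row_choices_def by auto

lemma row_minor_permute:
  assumes p: "p permutes {0..<m}"
  shows "row_minor X m (f \<circ> p) = signof p * row_minor X m f"
proof -
  have p_less: "p i < m" if "i < m" for i
    using permutes_in_image[OF p, of i] that by simp
  have "mat m m (\<lambda>(i, j). X $$ ((f \<circ> p) i, j)) =
    mat m m (\<lambda>(i, j). mat m m (\<lambda>(i, j). X $$ (f i, j)) $$ (p i, j))"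
    by (rule eq_matI) (auto simp: p_less)
  then show ?thesis
    unfolding row_minor_def using det_permute_rows[OF mat_carrier p] by simp
qed

lemma row_minor_eq_0:
  assumes "\<not> inj_on f {0..<m}"
  shows "row_minor X m f = 0"
proof -
  obtain i j where ij: "i \<noteq> j" "i < m" "j < m" "f i = f j"
    using assms unfolding inj_on_def by auto
  show ?thesis
    unfolding row_minor_def
    by (rule det_identical_rows[OF mat_carrier ij(1-3)]) (use ij in auto)
qed

text \<open>Summing over all functions instead of all \<open>m\<close>-element sets of rows counts each
  term \<open>m!\<close> times.\<close>

theorem Cauchy_Binet:
  fixes P X :: "'a :: comm_ring_1 mat"
  assumes P: "P \<in> carrier_mat m n" and X: "X \<in> carrier_mat n m"
  shows "of_nat (fact m) * det (P * X) =
    (\<Sum>f\<in>row_choices m n. row_minor (transpose_mat P) m f * row_minor X m f)"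
proof -
  let ?U = "{0..<m}"
  let ?perms = "{p. p permutes ?U}"
  \<comment> \<open>Row \<open>i\<close> of \<open>P * X\<close> combines the rows of
    \<open>X\<close> with the coefficients in row \<open>i\<close> of \<open>P\<close>.
    Multilinearity of \<open>det\<close> picks one summand \<open>f i\<close> for each
    \<open>i\<close>.\<close>
  have expand: "det (P * X) = (\<Sum>f\<in>row_choices m n. (\<Prod>i\<in>?U. P $$ (i, f i)) * row_minor X m f)"
  proof -
    have "det (P * X) =
      (\<Sum>f\<in>row_choices m n. det (mat\<^sub>r m m (\<lambda>i. P $$ (i, f i) \<cdot>\<^sub>v row X (f i))))"
      unfolding mat_mul_finsum_alt[OF P X] row_choices_def
      by (rule det_linear_rows_sum) (use P X in auto)
    also have "\<dots> = (\<Sum>f\<in>row_choices m n. (\<Prod>i\<in>?U. P $$ (i, f i)) * row_minor X m f)"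
    proof (rule sum.cong[OF refl])
      fix f assume f: "f \<in> row_choices m n"
      have "mat\<^sub>r m m (\<lambda>i. row X (f i)) = mat m m (\<lambda>(i, j). X $$ (f i, j))"
        using X row_choicesD[OF f] by (intro eq_matI) auto
      then show "det (mat\<^sub>r m m (\<lambda>i. P $$ (i, f i) \<cdot>\<^sub>v row X (f i))) =
        (\<Prod>i\<in>?U. P $$ (i, f i)) * row_minor X m f"
        unfolding row_minor_def using X by (subst det_rows_mul) auto
    qed
    finally show ?thesis .
  qed
  \<comment> \<open>Precomposition with \<open>p\<close> is a bijection of
    \<open>row_choices m n\<close>, so \<open>expand\<close> may be reindexed by it. The sign comes
    from reordering the rows of the minor of \<open>X\<close>.\<close>
  have permuted: "det (P * X) =
    (\<Sum>f\<in>row_choices m n. signof p * (\<Prod>i\<in>?U. P $$ (i, f (p i))) * row_minor X m f)"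
    if p: "p \<in> ?perms" for p
  proof -
    have p: "p permutes ?U" using that by simp
    have in_U: "p i < m \<longleftrightarrow> i < m" "Hilbert_Choice.inv p i < m \<longleftrightarrow> i < m" for i
      using permutes_in_image[OF p, of i] permutes_in_image[OF permutes_inv[OF p], of i] by simp_all
    have outside: "p i = i" "Hilbert_Choice.inv p i = i" if "\<not> i < m" for i
      using permutes_not_in[OF p, of i] permutes_not_in[OF permutes_inv[OF p], of i] that by simp_all
    have mem: "f \<circ> p \<in> row_choices m n" "f \<circ> Hilbert_Choice.inv p \<in> row_choices m n"
      if "f \<in> row_choices m n" for f
      using that in_U outside unfolding row_choices_def by auto
    have cancel: "f \<circ> p \<circ> Hilbert_Choice.inv p = f" "f \<circ> Hilbert_Choice.inv p \<circ> p = f" for f :: "nat \<Rightarrow> nat"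
      by (simp_all add: fun_eq_iff permutes_inverses[OF p])
    have "signof p * signof p = (1 :: 'a)"
      by (simp add: sign_def)
    then have "signof p * (\<Prod>i\<in>?U. P $$ (i, f (p i))) * row_minor X m f =
        (\<Prod>i\<in>?U. P $$ (i, (f \<circ> p) i)) * row_minor X m (f \<circ> p)" for f
      by (simp add: row_minor_permute[OF p] ac_simps)
    then show ?thesis
      unfolding expand
      by (intro sum.reindex_bij_witness[where i = "\<lambda>f. f \<circ> p"
            and j = "\<lambda>f. f \<circ> Hilbert_Choice.inv p"])
        (simp_all only: mem cancel)
  qed
  \<comment> \<open>Adding the \<open>fact m\<close> reindexed copies turns the coefficient of each
    minor of \<open>X\<close> into a Leibniz expansion, which is the matching minor of
    \<open>P\<close>.\<close>
  have "of_nat (fact m) * det (P * X) = (\<Sum>p\<in>?perms. det (P * X))"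
    by (simp add: card_permutations)
  also have "\<dots> = (\<Sum>p\<in>?perms. \<Sum>f\<in>row_choices m n.
      signof p * (\<Prod>i\<in>?U. P $$ (i, f (p i))) * row_minor X m f)"
    by (rule sum.cong[OF refl]) (rule permuted)
  also have "\<dots> = (\<Sum>f\<in>row_choices m n.
      (\<Sum>p\<in>?perms. signof p * (\<Prod>i\<in>?U. P $$ (i, f (p i)))) * row_minor X m f)"
    by (subst sum.swap) (simp add: sum_distrib_right)
  also have "\<dots> = (\<Sum>f\<in>row_choices m n. row_minor (transpose_mat P) m f * row_minor X m f)"
  proof (rule sum.cong[OF refl])
    fix f assume f: "f \<in> row_choices m n"
    have "row_minor (transpose_mat P) m f = det (mat m m (\<lambda>(i, j). P $$ (i, f j)))"
    proof -
      have "mat m m (\<lambda>(i, j). transpose_mat P $$ (f i, j)) =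
        transpose_mat (mat m m (\<lambda>(i, j). P $$ (i, f j)))"
        using P row_choicesD[OF f] by (intro eq_matI) auto
      then show ?thesis
        unfolding row_minor_def by (simp add: det_transpose[OF mat_carrier])
    qed
    also have "\<dots> = (\<Sum>p\<in>?perms. signof p * (\<Prod>i\<in>?U. P $$ (i, f (p i))))"
    proof -
      have "p i < m" if "p permutes ?U" "i < m" for p i
        using permutes_in_image[OF that(1), of i] that(2) by simp
      then show ?thesis
        by (subst det_def'[OF mat_carrier]) (auto intro!: sum.cong prod.cong)
    qed
    finally show "(\<Sum>p\<in>?perms. signof p * (\<Prod>i\<in>?U. P $$ (i, f (p i)))) * row_minor X m f =
      row_minor (transpose_mat P) m f * row_minor X m f" by simp
  qed
  finally show ?thesis .
qed

lemma row_minor_cnj: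
  fixes X :: "complex mat"
  assumes X: "X \<in> carrier_mat n m" and f: "f \<in> row_choices m n"
  shows "row_minor (transpose_mat (mat_adjoint X)) m f = cnj (row_minor X m f)"
proof -
  have "p i < m" if "p permutes {0..<m}" "i < m" for p i
    using permutes_in_image[OF that(1), of i] that(2) by simp
  moreover have "cnj (signof p) = signof p" for p :: "nat \<Rightarrow> nat"
    by (simp add: sign_def)
  ultimately show ?thesis
    unfolding row_minor_def det_def'[OF mat_carrier]
    using X row_choicesD[OF f] by (auto intro!: sum.cong prod.cong)
qed

text \<open>Up to the factor \<open>fact m\<close>, the determinant is the inner product of the
  vectors of minors of \<open>X\<close> and \<open>Y\<close>; this is the form to which
  Cauchy--Schwarz applies.\<close>

lemma Cauchy_Binet_adjoint:
  fixes X Y :: "complex mat"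
  assumes X: "X \<in> carrier_mat n m" and Y: "Y \<in> carrier_mat n m"
  shows "of_real (fact m) * det (mat_adjoint X * Y) =
    (\<Sum>f\<in>row_choices m n. cnj (row_minor X m f) * row_minor Y m f)"
proof -
  have "of_real (fact m) * det (mat_adjoint X * Y) = of_nat (fact m) * det (mat_adjoint X * Y)"
    by simp
  also have "\<dots> = (\<Sum>f\<in>row_choices m n. cnj (row_minor X m f) * row_minor Y m f)"
    unfolding Cauchy_Binet[OF mat_adjoint_carrier[OF X] Y]
    by (rule sum.cong) (simp_all add: row_minor_cnj[OF X])
  finally show ?thesis .
qed

lemma Cauchy_Binet_gram:
  fixes X :: "complex mat"
  assumes X: "X \<in> carrier_mat n m"
  shows "fact m * Re (det (mat_adjoint X * X)) = (\<Sum>f\<in>row_choices m n. (cmod (row_minor X m f))\<^sup>2)"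
proof -
  have "fact m * Re (det (mat_adjoint X * X)) = Re (of_real (fact m) * det (mat_adjoint X * X))"
    by (simp del: of_real_fact)
  also have "\<dots> = (\<Sum>f\<in>row_choices m n. (cmod (row_minor X m f))\<^sup>2)"
    unfolding Cauchy_Binet_adjoint[OF X X] Re_sum
    by (rule sum.cong) (simp_all add: cmod_power2 flip: power2_eq_square)
  finally show ?thesis .
qed

section \<open>Determinant bounds for compressions\<close>

text \<open>Cauchy--Schwarz is applied to the minors of \<open>Q\<close> and of
  \<open>A * Q\<close>. The former have squared norm \<open>fact m\<close> by orthonormality, and
  the latter give the Gram determinant of \<open>A * Q\<close>.\<close>

lemma det_compression_le_gram:
  fixes A Q :: "complex mat"
  assumes A: "A \<in> carrier_mat n n" and Q: "Q \<in> carrier_mat n m"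
    and ortho: "mat_adjoint Q * Q = 1\<^sub>m m"
  shows "(cmod (det (mat_adjoint Q * A * Q)))\<^sup>2 \<le> Re (det (mat_adjoint Q * (mat_adjoint A * A) * Q))"
proof -
  let ?F = "row_choices m n"
  let ?a = "\<lambda>f. cmod (row_minor Q m f)" and ?b = "\<lambda>f. cmod (row_minor (A * Q) m f)"
  have AQ: "A * Q \<in> carrier_mat n m" using A Q by simp
  note adj = mat_adjoint_carrier[OF A] mat_adjoint_carrier[OF Q]
  have "fact m * cmod (det (mat_adjoint Q * A * Q)) =
    cmod (of_real (fact m) * det (mat_adjoint Q * (A * Q)))"
    using assoc_mult_mat[OF adj(2) A Q] by (simp add: norm_mult)
  also have "\<dots> \<le> (\<Sum>f\<in>?F. \<bar>?a f\<bar> * \<bar>?b f\<bar>)"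
    unfolding Cauchy_Binet_adjoint[OF Q AQ]
    by (rule order_trans[OF norm_sum]) (simp add: norm_mult)
  also have "\<dots> \<le> L2_set ?a ?F * L2_set ?b ?F"
    by (rule L2_set_mult_ineq)
  finally have "(fact m * cmod (det (mat_adjoint Q * A * Q)))\<^sup>2 \<le> (L2_set ?a ?F * L2_set ?b ?F)\<^sup>2"
    by (rule power_mono) simp
  also have "\<dots> = (\<Sum>f\<in>?F. (?a f)\<^sup>2) * (\<Sum>f\<in>?F. (?b f)\<^sup>2)"
    unfolding L2_set_def by (simp add: power_mult_distrib sum_nonneg)
  \<comment> \<open>One factor \<open>fact m\<close> comes from each Gram determinant; that of
    \<open>Q\<close> is \<open>det (1\<^sub>m m) = 1\<close>.\<close>
  also have "\<dots> = (fact m)\<^sup>2 * Re (det (mat_adjoint (A * Q) * (A * Q)))"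
    unfolding Cauchy_Binet_gram[OF Q, symmetric] Cauchy_Binet_gram[OF AQ, symmetric]
    by (simp add: ortho power2_eq_square)
  also have "mat_adjoint (A * Q) * (A * Q) = mat_adjoint Q * (mat_adjoint A * A) * Q"
    unfolding mat_adjoint_mult[OF A Q]
    using assoc_mult_mat[OF adj(2) adj(1) AQ] assoc_mult_mat[OF adj(1) A Q]
      assoc_mult_mat[OF adj(2) mult_carrier_mat[OF adj(1) A] Q] by simp
  finally show ?thesis
    by (simp add: power_mult_distrib)
qed

text \<open>Induction on the size, removing the largest index \<open>M\<close> of \<open>S\<close>:
  a set of \<open>Suc m\<close> indices up to \<open>M\<close> forces \<open>m \<le> M\<close>,
  hence \<open>d M \<le> d m\<close>.\<close>

lemma prod_antimono_le_prod_initial: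
  fixes d :: "nat \<Rightarrow> real"
  assumes anti: "\<And>i j. i \<le> j \<Longrightarrow> j < n \<Longrightarrow> d j \<le> d i"
    and nonneg: "\<And>i. i < n \<Longrightarrow> 0 \<le> d i"
    and "S \<subseteq> {..<n}" "card S = m"
  shows "(\<Prod>i\<in>S. d i) \<le> (\<Prod>i<m. d i)"
  using assms(3,4)
proof (induction m arbitrary: S)
  case 0
  then show ?case using finite_subset[of S] by auto
next
  case (Suc m)
  have fin: "finite S" using Suc.prems finite_subset by blast
  have "S \<noteq> {}" using Suc.prems by auto
  define M where "M = Max S"
  have M: "M \<in> S" "M < n" "S \<subseteq> {..M}"
    using fin \<open>S \<noteq> {}\<close> Suc.prems unfolding M_def by auto
  have "m \<le> M"
    using card_mono[OF _ M(3)] Suc.prems by simp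
  then have "d M \<le> d m" using anti M by auto
  moreover have "(\<Prod>i\<in>S - {M}. d i) \<le> (\<Prod>i<m. d i)"
    using Suc.prems M fin by (intro Suc.IH) auto
  moreover have "0 \<le> (\<Prod>i\<in>S - {M}. d i)" "0 \<le> d m"
    using Suc.prems nonneg M \<open>m \<le> M\<close> by (auto intro!: prod_nonneg)
  moreover have "(\<Prod>i\<in>S. d i) = d M * (\<Prod>i\<in>S - {M}. d i)"
    using fin M by (simp add: prod.remove)
  ultimately show ?case
    by (simp add: mult.commute mult_mono)
qed

text \<open>The minors of \<open>D * X\<close> are those of \<open>X\<close> weighted by products of
  the \<open>d (f i)\<close>. So the determinant is a weighted mean of such products, because the
  squared moduli of the minors of \<open>X\<close> add up to \<open>fact m\<close>.\<close>

lemma det_compression_diag_le: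
  fixes X D :: "complex mat" and d :: "nat \<Rightarrow> real"
  assumes X: "X \<in> carrier_mat n m" and ortho: "mat_adjoint X * X = 1\<^sub>m m"
    and D: "D = mat n n (\<lambda>(i, j). if i = j then complex_of_real (d i) else 0)"
    and anti: "\<And>i j. i \<le> j \<Longrightarrow> j < n \<Longrightarrow> d j \<le> d i"
    and nonneg: "\<And>i. i < n \<Longrightarrow> 0 \<le> d i"
  shows "Re (det (mat_adjoint X * D * X)) \<le> (\<Prod>i<m. d i)"
proof -
  let ?F = "row_choices m n"
  have Dc: "D \<in> carrier_mat n n" unfolding D by simp
  have DX: "D * X \<in> carrier_mat n m" using Dc X by simp
  have DX_index: "(D * X) $$ (i, j) = of_real (d i) * X $$ (i, j)" if "i < n" "j < m" for i j
  proof -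
    have "(D * X) $$ (i, j) = (\<Sum>l = 0..<n. if l = i then of_real (d l) * X $$ (l, j) else 0)"
      using X that unfolding D by (simp add: scalar_prod_def if_distrib[of "\<lambda>z. z * _"] cong: if_cong)
    then show ?thesis using that by simp
  qed
  have minor_DX: "row_minor (D * X) m f = of_real (\<Prod>i = 0..<m. d (f i)) * row_minor X m f"
    if f: "f \<in> ?F" for f
  proof -
    have "mat m m (\<lambda>(i, j). (D * X) $$ (f i, j)) =
      mat\<^sub>r m m (\<lambda>i. of_real (d (f i)) \<cdot>\<^sub>v vec m (\<lambda>j. X $$ (f i, j)))"
      using row_choicesD[OF f] by (intro eq_matI) (auto simp: DX_index)
    moreover have "mat\<^sub>r m m (\<lambda>i. vec m (\<lambda>j. X $$ (f i, j))) = mat m m (\<lambda>(i, j). X $$ (f i, j))"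
      by (intro eq_matI) auto
    ultimately show ?thesis
      unfolding row_minor_def by (simp add: det_rows_mul)
  qed
  \<comment> \<open>An injective \<open>f\<close> selects \<open>m\<close> distinct indices, whose
    product is at most that of the first \<open>m\<close>. For any other \<open>f\<close> the minor
    vanishes.\<close>
  have bound: "(\<Prod>i = 0..<m. d (f i)) * (cmod (row_minor X m f))\<^sup>2 \<le>
      (\<Prod>i<m. d i) * (cmod (row_minor X m f))\<^sup>2" if f: "f \<in> ?F" for f
  proof (cases "inj_on f {0..<m}")
    case True
    have "(\<Prod>i = 0..<m. d (f i)) = (\<Prod>i\<in>f ` {0..<m}. d i)"
      using True by (simp add: prod.reindex)
    also have "\<dots> \<le> (\<Prod>i<m. d i)"
      using row_choicesD[OF f] True
      by (intro prod_antimono_le_prod_initial[OF anti nonneg]) (auto simp: card_image)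
    finally show ?thesis by (simp add: mult_right_mono)
  qed (simp add: row_minor_eq_0)
  have "fact m * Re (det (mat_adjoint X * D * X)) =
    Re (of_real (fact m) * det (mat_adjoint X * (D * X)))"
    using assoc_mult_mat[OF mat_adjoint_carrier[OF X] Dc X] by (simp del: of_real_fact)
  also have "\<dots> = (\<Sum>f\<in>?F. (\<Prod>i = 0..<m. d (f i)) * (cmod (row_minor X m f))\<^sup>2)"
  proof -
    have "cnj z * (of_real r * z) = of_real (r * (cmod z)\<^sup>2)" for r z
      using complex_norm_square[of z] by (simp add: ac_simps)
    then have "of_real (fact m) * det (mat_adjoint X * (D * X)) =
      of_real (\<Sum>f\<in>?F. (\<Prod>i = 0..<m. d (f i)) * (cmod (row_minor X m f))\<^sup>2)"
      unfolding Cauchy_Binet_adjoint[OF X DX] of_real_sum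
      by (intro sum.cong) (simp_all only: minor_DX)
    then show ?thesis by (simp only: Re_complex_of_real)
  qed
  also have "\<dots> \<le> (\<Prod>i<m. d i) * (\<Sum>f\<in>?F. (cmod (row_minor X m f))\<^sup>2)"
    unfolding sum_distrib_left by (rule sum_mono) (rule bound)
  also have "\<dots> = fact m * (\<Prod>i<m. d i)"
    unfolding Cauchy_Binet_gram[OF X, symmetric] by (simp add: ortho)
  finally show ?thesis by simp
qed

section \<open>Unitary triangularisation and diagonalisation\<close>

text \<open>Complete \<open>v\<close> to a basis and orthogonalise; Gram--Schmidt keeps the first
  vector, and normalising only rescales it.\<close>

lemma unitary_with_first_col:
  fixes v :: "complex vec"
  assumes v: "v \<in> carrier_vec n" and v0: "v \<noteq> 0\<^sub>v n"
  obtains U c where "U \<in> carrier_mat n n" "mat_adjoint U * U = 1\<^sub>m n" "col U 0 = c \<cdot>\<^sub>v v"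
proof -
  have n: "n \<noteq> 0" using v v0 by (auto intro!: eq_vecI)
  interpret cof_vec_space n "TYPE(complex)" .
  define b where "b = basis_completion v"
  define ws where "ws = gram_schmidt n b"
  note completion = basis_completion[OF v v0, folded b_def]
  have "hd b = v" "b \<noteq> []"
    unfolding b_def basis_completion_def by (simp_all add: Let_def)
  then obtain vs where b: "b = v # vs" by (cases b) auto
  have ws: "set ws \<subseteq> carrier_vec n" "corthogonal ws" "length ws = n"
    using gram_schmidt_result[OF completion(2,4,5) ws_def] completion(6) by auto
  have "hd ws = v"
    unfolding ws_def b by (rule gram_schmidt_hd[OF v])
  then have ws_0: "ws ! 0 = v"
    using ws(3) n by (cases ws) auto
  have ws_carrier: "ws ! j \<in> carrier_vec n" if "j < n" for j
    using ws that by (auto simp: subset_iff)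
  \<comment> \<open>The vectors \<open>ws\<close> are orthogonal but not of unit length;
    \<open>r j\<close> is the norm by which the \<open>j\<close>-th one is divided.\<close>
  define r where "r j = sqrt (\<Sum>l = 0..<n. (cmod (ws ! j $ l))\<^sup>2)" for j
  have self: "ws ! j \<bullet>c ws ! j = of_real ((r j)\<^sup>2)" if "j < n" for j
  proof -
    have "ws ! j \<bullet>c ws ! j = (\<Sum>l = 0..<n. of_real ((cmod (ws ! j $ l))\<^sup>2))"
      using ws_carrier[OF that] by (simp add: scalar_prod_def complex_norm_square del: of_real_power)
    then show ?thesis unfolding r_def by (simp add: sum_nonneg)
  qed
  \<comment> \<open>The predicate \<open>corthogonal\<close> also demands a nonzero product of each
    vector with itself.\<close>
  have r: "r j \<noteq> 0" if "j < n" for j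
    using corthogonalD[OF ws(2), of j j] ws(3) self[OF that] that by auto
  define U where "U = mat n n (\<lambda>(i, j). of_real (1 / r j) * ws ! j $ i)"
  have U: "U \<in> carrier_mat n n" unfolding U_def by simp
  have "mat_adjoint U * U = 1\<^sub>m n"
  proof (rule eq_matI)
    fix i j assume "i < dim_row (1\<^sub>m n)" "j < dim_col (1\<^sub>m n)"
    then have ij: "i < n" "j < n" by simp_all
    have "(mat_adjoint U * U) $$ (i, j) =
      (\<Sum>l = 0..<n. cnj (of_real (1 / r i) * ws ! i $ l) * (of_real (1 / r j) * ws ! j $ l))"
      using ij U by (simp add: scalar_prod_def) (simp add: U_def)
    also have "\<dots> = of_real (1 / r i) * of_real (1 / r j) * (ws ! j \<bullet>c ws ! i)"
      using ws_carrier[OF ij(1)] ws_carrier[OF ij(2)]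
      unfolding scalar_prod_def sum_distrib_left by (auto intro!: sum.cong)
    also have "\<dots> = (if i = j then 1 else 0)"
      using corthogonalD[OF ws(2), of j i] ws(3) ij self[OF ij(1)] r[OF ij(1)]
      by (auto simp: power2_eq_square)
    finally show "(mat_adjoint U * U) $$ (i, j) = 1\<^sub>m n $$ (i, j)"
      using ij by simp
  qed (use U in auto)
  moreover have "col U 0 = of_real (1 / r 0) \<cdot>\<^sub>v v"
    using n v ws_0 by (intro eq_vecI) (auto simp: U_def)
  ultimately show ?thesis using that U by blast
qed

lemma isometry_mult:
  fixes U V :: "complex mat"
  assumes U: "U \<in> carrier_mat n k" "mat_adjoint U * U = 1\<^sub>m k"
    and V: "V \<in> carrier_mat k m" "mat_adjoint V * V = 1\<^sub>m m"
  shows "mat_adjoint (U * V) * (U * V) = 1\<^sub>m m"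
proof -
  note adj = mat_adjoint_carrier[OF U(1)] mat_adjoint_carrier[OF V(1)]
  have "mat_adjoint (U * V) * (U * V) = mat_adjoint V * ((mat_adjoint U * U) * V)"
    unfolding mat_adjoint_mult[OF U(1) V(1)]
    using assoc_mult_mat[OF adj(2) adj(1) mult_carrier_mat[OF U(1) V(1)]]
      assoc_mult_mat[OF adj(1) U(1) V(1)] by simp
  then show ?thesis using U V by simp
qed

text \<open>Compressing in two stages is compressing once by the product. This joins the steps of
  the Schur recursion, and later carries a compression of the reduced model back to
  \<open>A\<close>.\<close>

lemma conj_mult:
  fixes A U F :: "complex mat"
  assumes A: "A \<in> carrier_mat n n" and U: "U \<in> carrier_mat n k" and F: "F \<in> carrier_mat k m"
  shows "mat_adjoint (U * F) * A * (U * F) = mat_adjoint F * (mat_adjoint U * A * U) * F"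
proof -
  note adj = mat_adjoint_carrier[OF U] mat_adjoint_carrier[OF F]
  show ?thesis
    unfolding mat_adjoint_mult[OF U F]
    by (simp add: assoc_mult_mat[OF adj(2) adj(1) A]
      assoc_mult_mat[OF adj(2) mult_carrier_mat[OF adj(1) A] mult_carrier_mat[OF U F]]
      assoc_mult_mat[OF mult_carrier_mat[OF adj(1) A] U F]
      assoc_mult_mat[OF adj(2) mult_carrier_mat[OF mult_carrier_mat[OF adj(1) A] U] F])
qed

text \<open>Deflation: an eigenvector for the head of \<open>es\<close> becomes the first column,
  and induction treats the trailing block. The diagonal follows the given order of
  \<open>es\<close>, so chosen eigenvalues can be placed in front.\<close>

theorem unitary_schur:
  fixes A :: "complex mat"
  assumes "A \<in> carrier_mat n n" "char_poly A = (\<Prod>e\<leftarrow>es. [:- e, 1:])"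
  shows "\<exists>U. U \<in> carrier_mat n n \<and> mat_adjoint U * U = 1\<^sub>m n \<and>
    upper_triangular (mat_adjoint U * A * U) \<and> diag_mat (mat_adjoint U * A * U) = es"
  using assms
proof (induction es arbitrary: n A)
  case Nil
  then have "n = 0" using degree_monic_char_poly[of A n] by simp
  then show ?case using Nil by (intro exI[of _ "1\<^sub>m 0"]) (auto simp: diag_mat_def)
next
  case (Cons e es)
  note A = Cons.prems(1)
  have "eigenvalue A e"
    unfolding eigenvalue_root_char_poly[OF A] Cons.prems(2) by simp
  then obtain v where v: "v \<in> carrier_vec n" "v \<noteq> 0\<^sub>v n" "A *\<^sub>v v = e \<cdot>\<^sub>v v"
    unfolding eigenvalue_def eigenvector_def using A by auto
  then have "n \<noteq> 0" by (auto intro!: eq_vecI)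
  then obtain k where n: "n = Suc k" by (cases n) auto
  obtain U c where U: "U \<in> carrier_mat n n" "mat_adjoint U * U = 1\<^sub>m n" "col U 0 = c \<cdot>\<^sub>v v"
    using unitary_with_first_col[OF v(1,2)] .
  note aU = mat_adjoint_carrier[OF U(1)]
  note U_right = mat_mult_left_right_inverse[OF aU U(1,2)]
  define C where "C = mat_adjoint U * A * U"
  have C: "C \<in> carrier_mat n n" using A U aU unfolding C_def by simp
  have "similar_mat C A"
    unfolding similar_mat_def
    using similar_mat_witI[OF U(2) U_right C_def C A aU U(1)] by blast
  then have char_C: "char_poly C = [:- e, 1:] * (\<Prod>e\<leftarrow>es. [:- e, 1:])"
    using char_poly_similar[of C A] Cons.prems(2) by simp
  \<comment> \<open>Column 0 of \<open>U\<close> is an eigenvector for \<open>e\<close>, so column 0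
    of \<open>C\<close> is \<open>e\<close> times column 0 of \<open>mat_adjoint U * U\<close>, the
    identity.\<close>
  have first_col: "C $$ (i, 0) = (if i = 0 then e else 0)" if i: "i < n" for i
  proof -
    have "A *\<^sub>v col U 0 = e \<cdot>\<^sub>v col U 0"
      unfolding U(3) using A v by (simp add: mult_mat_vec smult_smult_assoc mult.commute)
    moreover have "C $$ (i, 0) = row (mat_adjoint U) i \<bullet> (A *\<^sub>v col U 0)"
      using i n A U aU col_mult2[OF A U(1), of 0]
      unfolding C_def assoc_mult_mat[OF aU A U(1)] by simp
    moreover have "row (mat_adjoint U) i \<bullet> (e \<cdot>\<^sub>v col U 0) = e * (mat_adjoint U * U) $$ (i, 0)"
      using i n U(1) aU by (simp add: scalar_prod_smult_distrib[of _ n])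
    ultimately show ?thesis using i n U(2) by simp
  qed
  define R where "R = mat 1 k (\<lambda>(i, j). C $$ (i, Suc j))"
  define C' where "C' = mat k k (\<lambda>(i, j). C $$ (Suc i, Suc j))"
  let ?e = "mat 1 1 (\<lambda>_. e)"
  have R: "R \<in> carrier_mat 1 k" and C': "C' \<in> carrier_mat k k"
    unfolding R_def C'_def by simp_all
  have C_block: "C = four_block_mat ?e R (0\<^sub>m k 1) C'"
    using C first_col n unfolding R_def C'_def by (intro eq_matI) auto
  \<comment> \<open>Block triangularity splits off the factor of \<open>e\<close>; cancelling it
    leaves the trailing block with exactly the eigenvalues \<open>es\<close>.\<close>
  have "char_poly C = char_poly ?e * char_poly C'"
    unfolding C_block by (rule char_poly_four_block_zeros_col) (use R C' in auto)
  moreover have "char_poly ?e = [:- e, 1:]"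
    by (simp add: char_poly_defs det_def sign_def)
  ultimately have "char_poly C' = (\<Prod>e\<leftarrow>es. [:- e, 1:])"
    using char_C by (metis mult_cancel_left pCons_eq_0_iff zero_neq_one)
  then obtain W where W: "W \<in> carrier_mat k k" "mat_adjoint W * W = 1\<^sub>m k"
    "upper_triangular (mat_adjoint W * C' * W)" "diag_mat (mat_adjoint W * C' * W) = es"
    using Cons.IH[OF C'] by blast
  note aW = mat_adjoint_carrier[OF W(1)]
  \<comment> \<open>\<open>F\<close> extends \<open>W\<close> by 1 in the corner, so it preserves
    the first column of \<open>C\<close> and triangularises the trailing block. The required unitary
    matrix is \<open>U * F\<close>.\<close>
  define F where "F = four_block_mat (1\<^sub>m 1) (0\<^sub>m 1 k) (0\<^sub>m k 1) W"
  have F: "F \<in> carrier_mat n n"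
    using four_block_carrier_mat[OF one_carrier_mat[of 1] W(1)] n unfolding F_def by simp
  have aF: "mat_adjoint F = four_block_mat (1\<^sub>m 1) (0\<^sub>m 1 k) (0\<^sub>m k 1) (mat_adjoint W)"
    using W(1) F n by (intro eq_matI) (auto simp: F_def)
  have "mat_adjoint F * F = four_block_mat (1\<^sub>m 1) (0\<^sub>m 1 k) (0\<^sub>m k 1) (1\<^sub>m k)"
    unfolding aF unfolding F_def
    by (subst mult_four_block_mat[of _ 1 1 _ k _ k _ _ 1 _ k]) (use W aW in simp_all)
  then have "mat_adjoint F * F = 1\<^sub>m n"
    by (simp add: n)
  then have unitary: "mat_adjoint (U * F) * (U * F) = 1\<^sub>m n"
    by (rule isometry_mult[OF U(1,2) F])
  have "mat_adjoint F * C = four_block_mat ?e R (0\<^sub>m k 1) (mat_adjoint W * C')"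
    unfolding aF C_block
    by (subst mult_four_block_mat[of _ 1 1 _ k _ k _ _ 1 _ k]) (use R C' aW right_mult_zero_mat[OF aW] in auto)
  then have "mat_adjoint F * C * F = four_block_mat ?e (R * W) (0\<^sub>m k 1) (mat_adjoint W * C' * W)"
    unfolding F_def
    by (simp, subst mult_four_block_mat[of _ 1 1 _ k _ k _ _ 1 _ k]) (use R C' W aW in auto)
  then have T: "mat_adjoint (U * F) * A * (U * F) =
      four_block_mat ?e (R * W) (0\<^sub>m k 1) (mat_adjoint W * C' * W)"
    unfolding conj_mult[OF A U(1) F] C_def[symmetric] .
  have WCW: "mat_adjoint W * C' * W \<in> carrier_mat k k" using W aW C' by simp
  have "upper_triangular (mat_adjoint (U * F) * A * (U * F))"
    unfolding T by (rule upper_triangular_four_block[OF _ WCW _ W(3)]) auto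
  moreover have "diag_mat (mat_adjoint (U * F) * A * (U * F)) = e # es"
    unfolding T by (subst diag_four_block_mat[OF _ WCW]) (auto simp: W(4), simp add: diag_mat_def)
  ultimately show ?case
    using unitary mult_carrier_mat[OF U(1) F] by blast
qed

text \<open>The Schur form of a Hermitian matrix is again Hermitian, and an upper triangular
  Hermitian matrix is diagonal.\<close>

lemma hermitian_unitary_diagonal:
  fixes H :: "complex mat"
  assumes H: "H \<in> carrier_mat n n" "mat_adjoint H = H"
    and es: "char_poly H = (\<Prod>e\<leftarrow>es. [:- e, 1:])"
  obtains U where "U \<in> carrier_mat n n" "mat_adjoint U * U = 1\<^sub>m n"
    "mat_adjoint U * H * U = mat n n (\<lambda>(i, j). if i = j then es ! i else 0)"
proof -
  obtain U where U: "U \<in> carrier_mat n n" "mat_adjoint U * U = 1\<^sub>m n"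
    and T: "upper_triangular (mat_adjoint U * H * U)" "diag_mat (mat_adjoint U * H * U) = es"
    using unitary_schur[OF H(1) es] by blast
  define D where "D = mat_adjoint U * H * U"
  note aU = mat_adjoint_carrier[OF U(1)]
  have D: "D \<in> carrier_mat n n" using H U aU unfolding D_def by simp
  have "mat_adjoint D = mat_adjoint U * (mat_adjoint H * mat_adjoint (mat_adjoint U))"
    unfolding D_def mat_adjoint_mult[OF mult_carrier_mat[OF aU H(1)] U(1)]
    by (simp add: mat_adjoint_mult[OF aU H(1)])
  also have "\<dots> = D"
    unfolding D_def using assoc_mult_mat[OF aU H(1) U(1)] H(2) by simp
  finally have sym: "mat_adjoint D = D" .
  have lower: "D $$ (i, j) = 0" if "j < i" "i < n" for i j
    using T(1) that D unfolding D_def[symmetric] by auto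
  have "D $$ (i, j) = (if i = j then es ! i else 0)" if "i < n" "j < n" for i j
  proof -
    have "D $$ (i, j) = cnj (D $$ (j, i))"
      using that D by (subst sym[symmetric]) simp
    moreover have "es ! i = D $$ (i, i)"
      using that D T(2) unfolding D_def[symmetric] diag_mat_def by auto
    ultimately show ?thesis
      using that lower[of i j] lower[of j i] by (cases i j rule: linorder_cases) auto
  qed
  then have "D = mat n n (\<lambda>(i, j). if i = j then es ! i else 0)"
    using D by (intro eq_matI) auto
  then show ?thesis using that[OF U] unfolding D_def by blast
qed

section \<open>Eigenvalue multisets and singular values\<close>

text \<open>The characteristic polynomial is monic and splits over the complex numbers. Since
  \<open>es\<close> is any enumeration of the roots, the order is free to choose.\<close>

lemma char_poly_eq_prod_list:
  assumes M: "M \<in> carrier_mat n n" and es: "mset es = eigvals_mset M"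
  shows "char_poly M = (\<Prod>e\<leftarrow>es. [:- e, 1:])"
proof -
  have "(\<Prod>e\<leftarrow>es. [:- e, 1:]) = (\<Prod>x\<in>#eigvals_mset M. [:- x, 1:])"
    unfolding es[symmetric] by (simp flip: prod_mset_prod_list)
  also have "\<dots> = Polynomial.smult (lead_coeff (char_poly M)) (\<Prod>x\<in>#eigvals_mset M. [:- x, 1:])"
    using degree_monic_char_poly[OF M] by simp
  finally show ?thesis
    unfolding eigvals_mset_def complex_poly_decompose_multiset by simp
qed

lemma size_eigvals_mset:
  "M \<in> carrier_mat n n \<Longrightarrow> size (eigvals_mset M) = n"
  unfolding eigvals_mset_def size_proots_complex using degree_monic_char_poly by blast

lemma gram_adjoint:
  fixes A :: "complex mat"
  assumes A: "A \<in> carrier_mat n m"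
  shows "mat_adjoint (mat_adjoint A * A) = mat_adjoint A * A"
  unfolding mat_adjoint_mult[OF mat_adjoint_carrier[OF A] A] by simp

text \<open>Diagonalising by \<open>U\<close> turns the eigenvalues into diagonal entries of the
  Gram matrix of \<open>A * U\<close>, which are squared norms of its columns.\<close>

lemma eigvals_gram_nonneg:
  fixes A :: "complex mat"
  assumes A: "A \<in> carrier_mat n n" and z: "z \<in># eigvals_mset (mat_adjoint A * A)"
  shows "z = of_real (Re z)" "0 \<le> Re z"
proof -
  let ?H = "mat_adjoint A * A"
  have H: "?H \<in> carrier_mat n n" using A mat_adjoint_carrier[OF A] by simp
  obtain es where es: "mset es = eigvals_mset ?H" using ex_mset by blast
  have "length es = n" using arg_cong[OF es, of size] size_eigvals_mset[OF H] by simp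
  obtain U where U: "U \<in> carrier_mat n n" and "mat_adjoint U * U = 1\<^sub>m n"
    and D: "mat_adjoint U * ?H * U = mat n n (\<lambda>(i, j). if i = j then es ! i else 0)"
    using hermitian_unitary_diagonal[OF H gram_adjoint[OF A] char_poly_eq_prod_list[OF H es]] .
  obtain i where i: "i < n" "z = es ! i"
    using z \<open>length es = n\<close> unfolding es[symmetric] by (auto simp: in_set_conv_nth)
  note adj = mat_adjoint_carrier[OF A] mat_adjoint_carrier[OF U]
  have AU: "A * U \<in> carrier_mat n n" using A U by simp
  have "mat_adjoint (A * U) * (A * U) = mat_adjoint U * ?H * U"
    unfolding mat_adjoint_mult[OF A U]
    using assoc_mult_mat[OF adj(2) adj(1) AU] assoc_mult_mat[OF adj(1) A U]
      assoc_mult_mat[OF adj(2) mult_carrier_mat[OF adj(1) A] U] by simp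
  then have "z = (mat_adjoint (A * U) * (A * U)) $$ (i, i)"
    unfolding D using i by simp
  also have "\<dots> = (\<Sum>l = 0..<n. cnj ((A * U) $$ (l, i)) * (A * U) $$ (l, i))"
    using AU i A U by (simp add: scalar_prod_def)
  also have "\<dots> = of_real (\<Sum>l = 0..<n. (cmod ((A * U) $$ (l, i)))\<^sup>2)"
    unfolding of_real_sum complex_norm_square by (simp add: mult.commute)
  finally have "z = of_real (\<Sum>l = 0..<n. (cmod ((A * U) $$ (l, i)))\<^sup>2)" .
  then show "z = of_real (Re z)" "0 \<le> Re z"
    by (simp_all only: Re_complex_of_real) (simp add: sum_nonneg)
qed

text \<open>As the eigenvalues of the Gram matrix are real and nonnegative, \<open>Re\<close> and
  \<open>sqrt\<close> lose nothing, and squaring recovers them with multiplicity.\<close>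

lemma singular_values_properties:
  fixes A :: "complex mat"
  assumes A: "A \<in> carrier_mat n n"
  shows length_singular_values: "length (singular_values A) = n"
    and singular_values_antimono: "i \<le> j \<Longrightarrow> j < n \<Longrightarrow> singular_values A ! j \<le> singular_values A ! i"
    and singular_values_nonneg: "i < n \<Longrightarrow> 0 \<le> singular_values A ! i"
    and mset_singular_values_squared:
      "mset (map (\<lambda>x. of_real (x\<^sup>2)) (singular_values A)) = eigvals_mset (mat_adjoint A * A)"
proof -
  let ?H = "mat_adjoint A * A"
  have H: "?H \<in> carrier_mat n n" using A mat_adjoint_carrier[OF A] by simp
  have mset: "mset (singular_values A) = image_mset (\<lambda>z. sqrt (Re z)) (eigvals_mset ?H)"
    unfolding singular_values_def by simp
  show length: "length (singular_values A) = n"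
    using arg_cong[OF mset, of size] size_eigvals_mset[OF H] by simp
  show "i \<le> j \<Longrightarrow> j < n \<Longrightarrow> singular_values A ! j \<le> singular_values A ! i"
    using length unfolding singular_values_def
    by (intro sorted_rev_nth_mono) simp_all
  show "0 \<le> singular_values A ! i" if "i < n"
  proof -
    have "singular_values A ! i \<in># mset (singular_values A)" using that length by simp
    then show ?thesis
      unfolding mset using eigvals_gram_nonneg(2)[OF A] by auto
  qed
  have "mset (map (\<lambda>x. of_real (x\<^sup>2)) (singular_values A)) =
    image_mset (\<lambda>z. of_real ((sqrt (Re z))\<^sup>2)) (eigvals_mset ?H)"
    by (simp add: mset image_mset.compositionality comp_def)
  also have "\<dots> = image_mset (\<lambda>z. z) (eigvals_mset ?H)"
  proof (rule image_mset_cong)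
    fix z assume "z \<in># eigvals_mset ?H"
    from eigvals_gram_nonneg[OF A this] show "complex_of_real ((sqrt (Re z))\<^sup>2) = z"
      by simp
  qed
  finally show "mset (map (\<lambda>x. of_real (x\<^sup>2)) (singular_values A)) = eigvals_mset ?H"
    by simp
qed

section \<open>Singular value bound and count of unstable modes\<close>

text \<open>In the eigenbasis \<open>U\<close> of the Gram matrix, \<open>Q\<close> becomes
  \<open>X = mat_adjoint U * Q\<close>, still with orthonormal columns. The Gram bound then reduces
  to a diagonal matrix of squared singular values.\<close>

theorem det_compression_le_prod_singular_values:
  fixes A Q :: "complex mat"
  assumes A: "A \<in> carrier_mat n n" and Q: "Q \<in> carrier_mat n m"
    and ortho: "mat_adjoint Q * Q = 1\<^sub>m m" and "m \<le> n"
  shows "cmod (det (mat_adjoint Q * A * Q)) \<le> (\<Prod>i<m. singular_values A ! i)"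
proof -
  let ?H = "mat_adjoint A * A" and ?s = "\<lambda>i. singular_values A ! i"
  let ?es = "map (\<lambda>x. of_real (x\<^sup>2)) (singular_values A) :: complex list"
  note sv = singular_values_properties[OF A]
  have H: "?H \<in> carrier_mat n n" using A mat_adjoint_carrier[OF A] by simp
  obtain U where U: "U \<in> carrier_mat n n" "mat_adjoint U * U = 1\<^sub>m n"
    and D: "mat_adjoint U * ?H * U = mat n n (\<lambda>(i, j). if i = j then ?es ! i else 0)"
    using hermitian_unitary_diagonal[OF H gram_adjoint[OF A] char_poly_eq_prod_list[OF H sv(4)]] .
  note aU = mat_adjoint_carrier[OF U(1)]
  note U_right = mat_mult_left_right_inverse[OF aU U]
  define X where "X = mat_adjoint U * Q"
  have X: "X \<in> carrier_mat n m" using Q aU unfolding X_def by simp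
  have UX: "U * X = Q"
    unfolding X_def using assoc_mult_mat[OF U(1) aU Q] U_right Q by simp
  have X_ortho: "mat_adjoint X * X = 1\<^sub>m m"
    unfolding X_def by (rule isometry_mult[OF aU _ Q ortho]) (simp add: U_right)
  have D': "mat_adjoint U * ?H * U = mat n n (\<lambda>(i, j). if i = j then of_real ((?s i)\<^sup>2) else 0)"
    unfolding D using sv(1) by (intro cong_mat) auto
  have "Re (det (mat_adjoint Q * ?H * Q)) = Re (det (mat_adjoint X * (mat_adjoint U * ?H * U) * X))"
    using conj_mult[OF H U(1) X] unfolding UX by simp
  also have "\<dots> \<le> (\<Prod>i<m. (?s i)\<^sup>2)"
    by (rule det_compression_diag_le[OF X X_ortho D']) (auto intro!: power_mono sv)
  finally have "(cmod (det (mat_adjoint Q * A * Q)))\<^sup>2 \<le> (\<Prod>i<m. ?s i)\<^sup>2"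
    using det_compression_le_gram[OF A Q ortho] by (simp add: prod_power_distrib)
  moreover have "0 \<le> (\<Prod>i<m. ?s i)"
    using \<open>m \<le> n\<close> sv(3) by (intro prod_nonneg) auto
  ultimately show ?thesis by (rule power2_le_imp_le)
qed

text \<open>With the unstable eigenvalues first in the Schur form, its leading block of size
  \<open>m\<close> is triangular with exactly these on the diagonal, so its determinant has modulus
  at least 1.\<close>

lemma compression_det_unstable:
  fixes B :: "complex mat"
  assumes B: "B \<in> carrier_mat k k"
    and m: "m = size {# z \<in># eigvals_mset B. cmod z \<ge> 1 #}"
  obtains W where "W \<in> carrier_mat k m" "mat_adjoint W * W = 1\<^sub>m m"
    "cmod (det (mat_adjoint W * B * W)) \<ge> 1"
proof -
  obtain xs where xs: "mset xs = eigvals_mset B" using ex_mset by blast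
  define es where "es = filter (\<lambda>z. cmod z \<ge> 1) xs @ filter (\<lambda>z. \<not> cmod z \<ge> 1) xs"
  have es: "mset es = eigvals_mset B"
    unfolding es_def xs[symmetric] by (simp flip: multiset_partition)
  have m_length: "m = length (filter (\<lambda>z. cmod z \<ge> 1) xs)"
    unfolding m xs[symmetric] by (simp flip: mset_filter)
  have large: "cmod (es ! i) \<ge> 1" if "i < m" for i
    using nth_mem[of i "filter (\<lambda>z. cmod z \<ge> 1) xs"] that
    unfolding es_def m_length by (simp add: nth_append)
  have "m \<le> k"
    using size_filter_mset_lesseq[of "\<lambda>z. cmod z \<ge> 1" "eigvals_mset B"] size_eigvals_mset[OF B]
    unfolding m by simp
  obtain U where U: "U \<in> carrier_mat k k" "mat_adjoint U * U = 1\<^sub>m k"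
    and schur: "upper_triangular (mat_adjoint U * B * U)" "diag_mat (mat_adjoint U * B * U) = es"
    using unitary_schur[OF B char_poly_eq_prod_list[OF B es]] by blast
  note aU = mat_adjoint_carrier[OF U(1)]
  define T where "T = mat_adjoint U * B * U"
  have Tc: "T \<in> carrier_mat k k" using U(1) aU B unfolding T_def by simp
  \<comment> \<open>\<open>W\<close> consists of the first \<open>m\<close> Schur vectors.\<close>
  define W where "W = mat k m (\<lambda>(i, j). U $$ (i, j))"
  have W: "W \<in> carrier_mat k m" unfolding W_def by simp
  note aW = mat_adjoint_carrier[OF W]
  have cols: "col W j = col U j" if "j < m" for j
    using that \<open>m \<le> k\<close> U(1) by (intro eq_vecI) (auto simp: W_def)
  have rows: "row (mat_adjoint W) i = row (mat_adjoint U) i" if "i < m" for i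
    using that \<open>m \<le> k\<close> U(1) W by (intro eq_vecI) (auto simp: W_def)
  \<comment> \<open>Such an entry involves only columns \<open>i\<close> and \<open>j\<close> of
    \<open>U\<close>, which \<open>W\<close> shares. Taking \<open>M\<close> as the identity gives
    orthonormality, and \<open>M = B\<close> gives the leading block.\<close>
  have leading: "(mat_adjoint W * (M * W)) $$ (i, j) = (mat_adjoint U * (M * U)) $$ (i, j)"
    if "i < m" "j < m" "M \<in> carrier_mat k k" for i j M
  proof -
    have "col (M * W) j = col (M * U) j"
      using that \<open>m \<le> k\<close> U(1) W cols[of j] by (simp add: col_mult2[of _ k k])
    then show ?thesis
      using that \<open>m \<le> k\<close> U(1) W rows[of i] by simp
  qed
  have "mat_adjoint W * W = 1\<^sub>m m"
  proof (rule eq_matI)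
    fix i j assume "i < dim_row (1\<^sub>m m)" "j < dim_col (1\<^sub>m m)"
    then have "i < m" "j < m" by simp_all
    then show "(mat_adjoint W * W) $$ (i, j) = 1\<^sub>m m $$ (i, j)"
      using leading[of i j "1\<^sub>m k"] U W \<open>m \<le> k\<close> by simp
  qed (use W in simp_all)
  moreover have "cmod (det (mat_adjoint W * B * W)) \<ge> 1"
  proof -
    define S where "S = mat_adjoint W * B * W"
    have S: "S \<in> carrier_mat m m" using W aW B unfolding S_def by simp
    have S_index: "S $$ (i, j) = T $$ (i, j)" if "i < m" "j < m" for i j
      unfolding S_def T_def assoc_mult_mat[OF aW B W] assoc_mult_mat[OF aU B U(1)]
      by (rule leading[OF that B])
    have "upper_triangular S"
      using schur(1) S Tc \<open>m \<le> k\<close> S_index unfolding T_def[symmetric]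
      by (intro upper_triangularI) auto
    then have "det S = (\<Prod>i = 0..<m. S $$ (i, i))"
      using det_upper_triangular[OF _ S] S by (simp add: prod_list_diag_prod)
    also have "\<dots> = (\<Prod>i = 0..<m. es ! i)"
      using schur(2) Tc \<open>m \<le> k\<close> S_index unfolding T_def[symmetric]
      by (intro prod.cong) (auto simp: diag_mat_def)
    finally have "cmod (det S) = (\<Prod>i = 0..<m. cmod (es ! i))"
      by (simp add: prod_norm)
    then show ?thesis
      unfolding S_def using large by (auto intro!: prod_ge_1)
  qed
  ultimately show ?thesis using that W by blast
qed

theorem corollary2:
  fixes A :: "complex mat" and n p :: nat and s G :: "nat \<Rightarrow> real"
  assumes A: "A \<in> carrier_mat n n"
    and rho: "spectral_radius A < 1"
    and s: "\<And>j. 1 \<le> j \<Longrightarrow> j \<le> n \<Longrightarrow> s j = singular_values A ! (j - 1)"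
    and G: "\<And>j. 1 \<le> j \<Longrightarrow> j \<le> n \<Longrightarrow> G j = root j (\<Prod>i = 1..j. s i)"
    and p: "p = (if G 1 < 1 then 0 else Max {j \<in> {1..n}. G j \<ge> 1})"
  shows "\<forall>k V. 1 \<le> k \<and> k \<le> n \<and> V \<in> carrier_mat n k \<and> mat_adjoint V * V = 1\<^sub>m k \<longrightarrow>
    size {# z \<in># eigvals_mset (mat_adjoint V * A * V). cmod z \<ge> 1 #} \<le> p"
proof (intro allI impI, elim conjE)
  fix k and V :: "complex mat"
  assume k: "1 \<le> k" "k \<le> n" and V: "V \<in> carrier_mat n k" "mat_adjoint V * V = 1\<^sub>m k"
  let ?B = "mat_adjoint V * A * V"
  define m where "m = size {# z \<in># eigvals_mset ?B. cmod z \<ge> 1 #}"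
  have B: "?B \<in> carrier_mat k k" using V A mat_adjoint_carrier[OF V(1)] by simp
  have "m \<le> k"
    using size_filter_mset_lesseq[of "\<lambda>z. cmod z \<ge> 1" "eigvals_mset ?B"] size_eigvals_mset[OF B]
    unfolding m_def by simp
  show "m \<le> p"
  proof (cases "m = 0")
    case False
    then have m: "1 \<le> m" "m \<le> n" using \<open>m \<le> k\<close> k by simp_all
    note sv = singular_values_properties[OF A]
    obtain W where W: "W \<in> carrier_mat k m" "mat_adjoint W * W = 1\<^sub>m m"
      "cmod (det (mat_adjoint W * ?B * W)) \<ge> 1"
      using compression_det_unstable[OF B m_def] .
    \<comment> \<open>The columns of \<open>V * W\<close> are orthonormal, so the singular value
      bound applies to this compression of \<open>A\<close> itself.\<close>
    have "1 \<le> cmod (det (mat_adjoint (V * W) * A * (V * W)))"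
      unfolding conj_mult[OF A V(1) W(1)] by (rule W(3))
    also have "\<dots> \<le> (\<Prod>i<m. singular_values A ! i)"
      by (rule det_compression_le_prod_singular_values[OF A _ isometry_mult[OF V W(1,2)] m(2)])
        (use V W in simp)
    \<comment> \<open>The list counts from 0, whereas \<open>s\<close> counts from 1.\<close>
    also have "\<dots> = (\<Prod>i = 1..m. s i)"
      using m(2) by (intro prod.reindex_bij_witness[of _ "\<lambda>i. i - 1" Suc]) (auto simp: s)
    finally have prod_ge: "1 \<le> (\<Prod>i = 1..m. s i)" .
    have "G m \<ge> 1"
      using prod_ge m by (simp add: G real_root_ge_1_iff)
    \<comment> \<open>This excludes the branch \<open>p = 0\<close>: if \<open>s 1 < 1\<close>, all
      later singular values are below 1 too, and so is their product, against
      \<open>prod_ge\<close>.\<close>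
    moreover have "G 1 \<ge> 1"
    proof (rule ccontr)
      assume "\<not> G 1 \<ge> 1"
      then have "s 1 < 1" using m by (simp add: G)
      then have "0 \<le> s i \<and> s i < 1" if "i \<in> {1..m}" for i
      proof -
        have i: "1 \<le> i" "i \<le> n" "i - 1 < n" using that m by auto
        show ?thesis
          using sv(2)[OF le0 i(3)] sv(3)[OF i(3)] \<open>s 1 < 1\<close> i m by (simp add: s)
      qed
      then have "(\<Prod>i = 1..m. s i) < (\<Prod>i = 1..m. 1)"
        using m by (intro prod_mono_strict[of 1]) (auto simp: less_imp_le)
      then show False using prod_ge by simp
    qed
    ultimately show ?thesis
      using m unfolding p by (auto intro!: Max_ge)
  qed simp
qed

end
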